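(* For a prime power $q\equiv 1\pmod 4$, let $k_4=k_4(q)$ be the number of $4$-vertex cliques in the $q$-vertex Paley graph. Then $$k_4=\frac{q^4}{1536}+O(q^{7/2}),$$ and so, as $q\to\infty$, $$k_4\sim \frac{q^4}{1536}.$$
   Context: Here $q=p^r$ ranges over all prime powers ($p$ prime, $r\ge 1$) with $q\equiv 1\pmod 4$. The $q$-vertex Paley graph has vertex set $\mathrm{GF}(q)$ and edges all $\{x,y\}$ with $x\neq y$ and $x-y$ a quadratic residue (nonzero square) in $\mathrm{GF}(q)$. A $4$-vertex clique is a $4$-element set of vertices that are pairwise adjacent. The implied constant in $O(\cdot)$ is absolute. *)

theory Defs
  imports
    "HOL-Library.Landau_Symbols"
    "HOL-Library.Ramsey"
    "HOL-Number_Theory.Prime_Powers"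
    "HOL-Algebra.Ring"
    "HOL-Algebra.Coset"
begin

text \<open>
  Finite fields occur here as objects (records with a carrier), not as types, so that one can
  quantify over all of them inside a formula.  There is only one field with \<open>q\<close> elements up to
  isomorphism; \<open>GF q\<close> collects all its copies whose carrier lies in the type \<open>'a\<close>.
  On an infinite type such as \<open>nat\<close> every finite field has such a copy, so a bound that is
  uniform in \<open>q\<close> and in the members of \<open>GF q\<close> on \<open>nat\<close> is uniform in all finite fields.
  Finiteness of the carrier follows from \<open>order F = q\<close> for \<open>q > 0\<close>.
\<close>

definition GF :: "nat \<Rightarrow> 'a ring set" where
  "GF q = {F. field F \<and> Coset.order F = q}"

definition quadratic_residue :: "'a ring \<Rightarrow> 'a \<Rightarrow> bool" where
  "quadratic_residue F a \<longleftrightarrow>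
     a \<noteq> \<zero>\<^bsub>F\<^esub> \<and> (\<exists>z\<in>carrier F. a = z [^]\<^bsub>F\<^esub> (2::nat))"

definition paley_edges :: "'a ring \<Rightarrow> 'a set set" where
  "paley_edges F =
     {{x, y} |x y. x \<in> carrier F \<and> y \<in> carrier F \<and> x \<noteq> y \<and>
        quadratic_residue F (x \<ominus>\<^bsub>F\<^esub> y)}"

definition k4 :: "'a ring \<Rightarrow> nat" where
  "k4 F = card {K. K \<subseteq> carrier F \<and> card K = 4 \<and> clique K (paley_edges F)}"

definition paley_order :: "nat \<Rightarrow> bool" where
  "paley_order q \<longleftrightarrow> primepow q \<and> q mod 4 = 1"

text \<open>
  The limit \<open>q \<rightarrow> \<infinity>\<close> over prime powers \<open>q \<equiv> 1 (mod 4)\<close>, as a filter on the fields of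
  order \<open>q\<close>: a property holds eventually iff for some \<open>N\<close> it holds for every such field
  with \<open>q \<ge> N\<close>.
\<close>

definition paley_at_top :: "'a ring filter" where
  "paley_at_top =
     inf (filtercomap Coset.order at_top) (principal (\<Union>q\<in>{q. paley_order q}. GF q))"

end

theory Submission
  imports
    Defs
    "HOL-Algebra.Multiplicative_Group"
    "HOL-Analysis.Convex"
    "HOL-Combinatorics.Multiset_Permutations"
begin

text \<open>
  The Paley graph on \<open>q\<close> vertices is a conference graph: every vertex has \<open>(q - 1) / 2\<close>
  neighbours, and two distinct vertices have \<open>(q - 5) / 4\<close> or \<open>(q - 1) / 4\<close> common neighbours
  according to whether they are adjacent or not.  These numbers alone determine the number of
  4-cliques up to an error of order \<open>q powr (7 / 2)\<close>.

  Let \<open>A\<close> be the adjacency matrix and \<open>W = A - 1 / 2\<close>.  The codegrees say that the rows of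
  \<open>W\<close> are almost orthogonal, with squared length \<open>q / 4\<close>, so by the Cauchy-Schwarz inequality
  the bilinear form of \<open>W\<close> is at most \<open>q powr (3 / 2)\<close> on vectors with entries in \<open>[-1, 1]\<close>
  (\<open>bilinear_discrepancy\<close>); this is the expander mixing lemma.  Apply it to the indicator of
  the common neighbourhood of an edge \<open>ab\<close>.  This set has exactly \<open>(q - 5) / 4\<close> elements,
  hence it spans \<open>(q - 5)\<^sup>2 / 32\<close> ordered edges \<open>cd\<close> up to an error \<open>q powr (3 / 2)\<close>.
  Summing over the \<open>q (q - 1) / 2\<close> ordered edges \<open>ab\<close> gives \<open>q ^ 4 / 64\<close> ordered
  4-cliques up to an error of order \<open>q powr (7 / 2)\<close> (\<open>card_4_cliques\<close>), and every clique
  is ordered in 24 ways.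

  The codegrees of the Paley graph come from the quadratic character \<open>chi\<close>.  Its values on the
  powers of a primitive element alternate between \<open>1\<close> and \<open>-1\<close>, so it is multiplicative
  and sums to \<open>0\<close>, and \<open>chi x * chi (x + c) = chi (1 + c / x)\<close> turns the correlation of
  \<open>chi\<close> with a translate into a sum of \<open>chi\<close> over all elements but \<open>1\<close>, which is
  \<open>-1\<close> (\<open>sum_chi_chi_shift\<close>).
\<close>

section \<open>Ordered and unordered 4-cliques\<close>

text \<open>
  A 4-tuple of pairwise adjacent vertices has distinct entries, since adjacency is irreflexive,
  so it is one of the \<open>4!\<close> enumerations of a clique.
\<close>

lemma sum_of_bool_ordered_4_cliques:
  fixes adj :: "'a \<Rightarrow> 'a \<Rightarrow> bool"
  assumes fin: "finite V"
    and sym: "\<And>x y. x \<in> V \<Longrightarrow> y \<in> V \<Longrightarrow> adj x y \<Longrightarrow> adj y x"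
    and irrefl: "\<And>x. x \<in> V \<Longrightarrow> \<not> adj x x"
  shows "(\<Sum>a\<in>V. \<Sum>b\<in>V. \<Sum>c\<in>V. \<Sum>d\<in>V. of_bool (adj a b \<and> adj a c \<and> adj b c
            \<and> adj a d \<and> adj b d \<and> adj c d) :: real)
         = 24 * real (card {K. K \<subseteq> V \<and> card K = 4 \<and> (\<forall>x\<in>K. \<forall>y\<in>K. x \<noteq> y \<longrightarrow> adj x y)})"
proof -
  define P where "P = (\<lambda>(a, b, c, d). adj a b \<and> adj a c \<and> adj b c \<and> adj a d \<and> adj b d \<and> adj c d)"
  define T where "T = {t \<in> V \<times> V \<times> V \<times> V. P t}"
  define KK where "KK = {K. K \<subseteq> V \<and> card K = 4 \<and> (\<forall>x\<in>K. \<forall>y\<in>K. x \<noteq> y \<longrightarrow> adj x y)}"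
  define h :: "'a \<times> 'a \<times> 'a \<times> 'a \<Rightarrow> 'a list" where "h = (\<lambda>(a, b, c, d). [a, b, c, d])"
  have finK: "finite K" if "K \<in> KK" for K
    using that fin by (auto simp: KK_def intro: finite_subset)
  have finKK: "finite KK"
    by (rule finite_subset[of _ "Pow V"]) (use fin in \<open>auto simp: KK_def\<close>)
  have "(\<Sum>a\<in>V. \<Sum>b\<in>V. \<Sum>c\<in>V. \<Sum>d\<in>V. of_bool (adj a b \<and> adj a c \<and> adj b c
            \<and> adj a d \<and> adj b d \<and> adj c d) :: real) = (\<Sum>t\<in>V \<times> V \<times> V \<times> V. of_bool (P t))"
    by (simp add: sum.cartesian_product P_def case_prod_beta)
  also have "\<dots> = real (card T)"
    using fin by (simp add: T_def Int_def)
  also have "card T = card (h ` T)"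
    by (rule card_image[symmetric]) (auto simp: inj_on_def h_def)
  also have "h ` T = (\<Union>K\<in>KK. permutations_of_set K)"
  proof (intro equalityI subsetI)
    fix xs assume "xs \<in> h ` T"
    then obtain a b c d where xs: "xs = [a, b, c, d]" and V: "a \<in> V" "b \<in> V" "c \<in> V" "d \<in> V"
      and adj: "adj a b" "adj a c" "adj b c" "adj a d" "adj b d" "adj c d"
      by (auto simp: h_def T_def P_def)
    have ne: "a \<noteq> b" "a \<noteq> c" "b \<noteq> c" "a \<noteq> d" "b \<noteq> d" "c \<noteq> d"
      using adj V irrefl by auto
    have "{a, b, c, d} \<in> KK"
      unfolding KK_def using ne V adj sym by auto
    moreover have "xs \<in> permutations_of_set {a, b, c, d}"
      using ne xs by (auto simp: permutations_of_set_def)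
    ultimately show "xs \<in> (\<Union>K\<in>KK. permutations_of_set K)" by blast
  next
    fix xs assume "xs \<in> (\<Union>K\<in>KK. permutations_of_set K)"
    then obtain K where K: "K \<in> KK" and xs: "set xs = K" "distinct xs"
      by (auto simp: permutations_of_set_def)
    have "length xs = 4"
      using distinct_card[OF xs(2)] K xs(1) by (simp add: KK_def)
    then obtain a b c d where abcd: "xs = [a, b, c, d]"
      by (auto simp: length_Suc_conv numeral_eq_Suc)
    have "(a, b, c, d) \<in> T"
      using K xs abcd unfolding KK_def T_def P_def by auto
    moreover have "xs = h (a, b, c, d)"
      by (simp add: h_def abcd)
    ultimately show "xs \<in> h ` T" by blast
  qed
  also have "card \<dots> = (\<Sum>K\<in>KK. card (permutations_of_set K))"
    using finKK by (intro card_UN_disjoint ballI impI) (simp_all, auto simp: permutations_of_set_def)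
  also have "\<dots> = (\<Sum>K\<in>KK. 24)"
    by (intro sum.cong refl, subst card_permutations_of_set)
       (auto simp: finK, auto simp: KK_def fact_numeral)
  finally show ?thesis by (simp add: KK_def)
qed

section \<open>Conference graphs\<close>

text \<open>
  A conference graph is a strongly regular graph with parameters
  \<open>(n, (n - 1) / 2, (n - 5) / 4, (n - 1) / 4)\<close>.  The equations are cleared of denominators and
  subtractions so that they hold in the natural numbers without truncation.
\<close>

locale conference_graph =
  fixes V :: "'a set" and adj :: "'a \<Rightarrow> 'a \<Rightarrow> bool"
  assumes finite_V: "finite V"
    and adj_sym: "\<And>x y. x \<in> V \<Longrightarrow> y \<in> V \<Longrightarrow> adj x y \<Longrightarrow> adj y x"
    and adj_irrefl: "\<And>x. x \<in> V \<Longrightarrow> \<not> adj x x"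
    and degree: "\<And>x. x \<in> V \<Longrightarrow> 2 * card {z \<in> V. adj x z} + 1 = card V"
    and codegree_adjacent: "\<And>x y. x \<in> V \<Longrightarrow> y \<in> V \<Longrightarrow> adj x y \<Longrightarrow>
           4 * card {z \<in> V. adj x z \<and> adj y z} + 5 = card V"
    and codegree_nonadjacent: "\<And>x y. x \<in> V \<Longrightarrow> y \<in> V \<Longrightarrow> x \<noteq> y \<Longrightarrow> \<not> adj x y \<Longrightarrow>
           4 * card {z \<in> V. adj x z \<and> adj y z} + 1 = card V"
begin

abbreviation n :: real where "n \<equiv> real (card V)"

abbreviation A :: "'a \<Rightarrow> 'a \<Rightarrow> real" where "A x y \<equiv> of_bool (adj x y)"

abbreviation W :: "'a \<Rightarrow> 'a \<Rightarrow> real" where "W x y \<equiv> A x y - 1 / 2"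

lemma sum_A: "x \<in> V \<Longrightarrow> (\<Sum>z\<in>V. A x z) = (n - 1) / 2"
  using degree[of x] finite_V by (simp add: Int_def)

lemma sum_A_A:
  "(\<Sum>z\<in>V. A x z * A y z) = real (card {z \<in> V. adj x z \<and> adj y z})"
  using finite_V by (simp add: Int_def flip: of_bool_conj)

lemma sum_A_A_adjacent:
  assumes "x \<in> V" "y \<in> V" "adj x y"
  shows "(\<Sum>z\<in>V. A x z * A y z) = (n - 5) / 4"
  using codegree_adjacent[OF assms] unfolding sum_A_A by simp

lemma sum_W_W:
  assumes "x \<in> V" "y \<in> V"
  shows "(\<Sum>z\<in>V. W x z * W y z) = (\<Sum>z\<in>V. A x z * A y z) - n / 4 + 1 / 2"
proof -
  have "(\<Sum>z\<in>V. W x z * W y z) = (\<Sum>z\<in>V. A x z * A y z - A x z / 2 - A y z / 2 + 1 / 4)"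
    by (intro sum.cong refl) (simp add: algebra_simps)
  also have "\<dots> = (\<Sum>z\<in>V. A x z * A y z) - (\<Sum>z\<in>V. A x z) / 2 - (\<Sum>z\<in>V. A y z) / 2 + n / 4"
    by (simp add: sum.distrib sum_subtractf sum_divide_distrib)
  finally show ?thesis using sum_A assms by (simp add: field_simps)
qed

text \<open>
  The Gram matrix of \<open>W\<close>.  The off-diagonal entries are \<open>-3 / 4\<close> and \<open>1 / 4\<close>, for
  adjacent and non-adjacent vertices.
\<close>

lemma abs_sum_W_W:
  assumes "x \<in> V" "y \<in> V"
  shows "\<bar>\<Sum>z\<in>V. W x z * W y z\<bar> \<le> (if x = y then n / 4 else 3 / 4)"
proof (cases "x = y")
  case True
  have "(\<Sum>z\<in>V. W x z * W x z) = (\<Sum>z\<in>V. 1 / 4)"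
    by (intro sum.cong refl) (simp add: of_bool_def)
  then show ?thesis using True by simp
next
  case False
  then show ?thesis
    using codegree_adjacent[OF assms] codegree_nonadjacent[OF assms]
    unfolding sum_W_W[OF assms] unfolding sum_A_A by (cases "adj x y") auto
qed

text \<open>
  The expander mixing lemma.  By Cauchy-Schwarz the square of the form is at most \<open>n\<close> times the
  squared length of \<open>W v\<close>.  The latter is a quadratic form in \<open>v\<close> whose matrix is the Gram
  matrix of \<open>W\<close>, so it is at most the sum \<open>n (n - 3 / 4)\<close> of the bounds on the absolute
  values of its entries.
\<close>

lemma bilinear_discrepancy:
  fixes u v :: "'a \<Rightarrow> real"
  assumes u: "\<And>x. x \<in> V \<Longrightarrow> \<bar>u x\<bar> \<le> 1" and v: "\<And>x. x \<in> V \<Longrightarrow> \<bar>v x\<bar> \<le> 1"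
  shows "\<bar>\<Sum>x\<in>V. \<Sum>y\<in>V. u x * v y * W x y\<bar> \<le> n powr (3 / 2)"
proof -
  define w where "w = (\<lambda>x. \<Sum>y\<in>V. v y * W x y)"
  have W_sym: "W x y = W y x" if "x \<in> V" "y \<in> V" for x y
    using adj_sym that by (auto simp: of_bool_def)
  have "(\<Sum>x\<in>V. (w x)\<^sup>2) = (\<Sum>x\<in>V. \<Sum>y\<in>V. \<Sum>z\<in>V. (v y * v z) * (W x y * W x z))"
    unfolding w_def power2_eq_square by (simp only: sum_product mult_ac)
  also have "\<dots> = (\<Sum>y\<in>V. \<Sum>x\<in>V. \<Sum>z\<in>V. (v y * v z) * (W x y * W x z))"
    by (rule sum.swap)
  also have "\<dots> = (\<Sum>y\<in>V. \<Sum>z\<in>V. \<Sum>x\<in>V. (v y * v z) * (W x y * W x z))"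
    by (intro sum.cong refl sum.swap)
  also have "\<dots> = (\<Sum>y\<in>V. \<Sum>z\<in>V. (v y * v z) * (\<Sum>x\<in>V. W y x * W z x))"
    unfolding sum_distrib_left
    by (intro sum.cong refl) (simp only: W_sym)
  also have "\<dots> \<le> (\<Sum>y\<in>V. \<Sum>z\<in>V. if y = z then n / 4 else 3 / 4)"
  proof (intro sum_mono)
    fix y z assume yz: "y \<in> V" "z \<in> V"
    have "\<bar>v y * v z\<bar> \<le> 1"
      using v[OF yz(1)] v[OF yz(2)] by (simp add: abs_mult mult_le_one)
    then have "\<bar>(v y * v z) * (\<Sum>x\<in>V. W y x * W z x)\<bar> \<le> 1 * \<bar>\<Sum>x\<in>V. W y x * W z x\<bar>"
      unfolding abs_mult[of "v y * v z"] by (intro mult_right_mono) auto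
    then show "(v y * v z) * (\<Sum>x\<in>V. W y x * W z x) \<le> (if y = z then n / 4 else 3 / 4)"
      using abs_sum_W_W[OF yz] by linarith
  qed
  also have "\<dots> = (\<Sum>y\<in>V. n - 3 / 4)"
  proof (rule sum.cong[OF refl])
    fix y assume "y \<in> V"
    have "(\<Sum>z\<in>V - {y}. if y = z then n / 4 else 3 / 4) = (\<Sum>z\<in>V - {y}. 3 / 4)"
      by (rule sum.cong) auto
    then have "(\<Sum>z\<in>V. if y = z then n / 4 else 3 / 4) = n / 4 + (\<Sum>z\<in>V - {y}. 3 / 4)"
      using \<open>y \<in> V\<close> by (subst sum.remove[OF finite_V, of y]) simp_all
    also have "\<dots> = n / 4 + (n - 1) * (3 / 4)"
      using \<open>y \<in> V\<close> finite_V card_gt_0_iff[of V] by (auto simp: of_nat_diff)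
    also have "\<dots> = n - 3 / 4"
      by (simp add: field_simps)
    finally show "(\<Sum>z\<in>V. if y = z then n / 4 else 3 / 4) = n - 3 / 4" .
  qed
  also have "\<dots> \<le> n\<^sup>2"
    by (simp add: power2_eq_square algebra_simps)
  finally have w: "(\<Sum>x\<in>V. (w x)\<^sup>2) \<le> n\<^sup>2" .
  have "(\<Sum>x\<in>V. (u x)\<^sup>2) \<le> (\<Sum>x\<in>V. 1)"
    using u by (intro sum_mono) (simp add: abs_square_le_1)
  then have u2: "(\<Sum>x\<in>V. (u x)\<^sup>2) \<le> n" by simp
  have "(\<Sum>x\<in>V. u x * w x)\<^sup>2 \<le> (\<Sum>x\<in>V. (u x)\<^sup>2) * (\<Sum>x\<in>V. (w x)\<^sup>2)"
    by (rule Cauchy_Schwarz_ineq_sum)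
  also have "\<dots> \<le> n * n\<^sup>2"
    by (intro mult_mono u2 w sum_nonneg) auto
  also have "\<dots> = (n powr (3 / 2))\<^sup>2"
  proof (cases "n = 0")
    case False
    have "(n powr (3 / 2))\<^sup>2 = n powr (3 / 2 + 3 / 2)"
      by (simp only: power2_eq_square powr_add)
    also have "\<dots> = n ^ 3"
      using False by (simp add: powr_numeral)
    finally show ?thesis by (simp add: power2_eq_square power3_eq_cube)
  qed simp
  finally have "\<bar>\<Sum>x\<in>V. u x * w x\<bar> \<le> n powr (3 / 2)"
    by (metis abs_le_square_iff abs_of_nonneg powr_ge_zero)
  then show ?thesis
    by (simp add: w_def sum_distrib_left mult.assoc)
qed

text \<open>
  With \<open>t\<close> the indicator of the common neighbourhood of \<open>a\<close> and \<open>b\<close>, write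
  \<open>A = 1 / 2 + W\<close> in the double sum: the constant part contributes half the square of the
  codegree, and the part with \<open>W\<close> is small by \<open>bilinear_discrepancy\<close>.
\<close>

lemma common_neighbourhood_edges:
  assumes ab: "a \<in> V" "b \<in> V" "adj a b"
  shows "\<bar>(\<Sum>c\<in>V. \<Sum>d\<in>V. A a c * A b c * (A a d * A b d) * A c d) - (n - 5)\<^sup>2 / 32\<bar>
           \<le> n powr (3 / 2)"
proof -
  define t where "t = (\<lambda>c. A a c * A b c)"
  have "(\<Sum>c\<in>V. \<Sum>d\<in>V. t c * t d * A c d)
        = (\<Sum>c\<in>V. \<Sum>d\<in>V. t c * t d * W c d + (t c * t d) / 2)"
    by (intro sum.cong refl) (simp add: algebra_simps)
  also have "\<dots> = (\<Sum>c\<in>V. \<Sum>d\<in>V. t c * t d * W c d) + (\<Sum>c\<in>V. t c) * (\<Sum>d\<in>V. t d) / 2"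
    by (simp add: sum.distrib sum_divide_distrib sum_product)
  also have "(\<Sum>c\<in>V. t c) = (n - 5) / 4"
    unfolding t_def by (rule sum_A_A_adjacent[OF ab])
  finally have "(\<Sum>c\<in>V. \<Sum>d\<in>V. t c * t d * A c d) - (n - 5)\<^sup>2 / 32
      = (\<Sum>c\<in>V. \<Sum>d\<in>V. t c * t d * W c d)"
    by (simp add: power2_eq_square)
  moreover have "\<bar>\<Sum>c\<in>V. \<Sum>d\<in>V. t c * t d * W c d\<bar> \<le> n powr (3 / 2)"
    by (rule bilinear_discrepancy) (auto simp: t_def of_bool_def)
  ultimately show ?thesis unfolding t_def by simp
qed

text \<open>
  Summing the previous estimate over all ordered edges \<open>ab\<close> costs \<open>n\<^sup>2\<close> errors of size
  \<open>n powr (3 / 2)\<close>.  The main term \<open>n (n - 1) (n - 5)\<^sup>2 / 64\<close> differs from \<open>n ^ 4 / 64\<close>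
  by at most \<open>n ^ 3\<close>, hence by no more than a second error \<open>n powr (7 / 2)\<close>; dividing
  \<open>2 * n powr (7 / 2)\<close> by 24 gives the constant \<open>1 / 12\<close>.
\<close>

theorem card_4_cliques:
  "\<bar>real (card {K. K \<subseteq> V \<and> card K = 4 \<and> (\<forall>x\<in>K. \<forall>y\<in>K. x \<noteq> y \<longrightarrow> adj x y)}) - n ^ 4 / 1536\<bar>
     \<le> n powr (7 / 2) / 12"
proof (cases "V = {}")
  case True
  then show ?thesis by auto
next
  case False
  then have n1: "n \<ge> 1"
    using finite_V by (simp add: Suc_le_eq card_gt_0_iff)
  define S where "S = (\<lambda>a b. \<Sum>c\<in>V. \<Sum>d\<in>V. A a c * A b c * (A a d * A b d) * A c d)"
  define N where "N = (\<Sum>a\<in>V. \<Sum>b\<in>V. A a b * S a b)"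
  have N: "N = 24 * real (card {K. K \<subseteq> V \<and> card K = 4 \<and> (\<forall>x\<in>K. \<forall>y\<in>K. x \<noteq> y \<longrightarrow> adj x y)})"
    unfolding N_def S_def sum_distrib_left
    by (subst sum_of_bool_ordered_4_cliques[symmetric, OF finite_V adj_sym adj_irrefl])
       (auto intro!: sum.cong)
  have "N - n * (n - 1) / 2 * ((n - 5)\<^sup>2 / 32)
      = N - (\<Sum>a\<in>V. \<Sum>b\<in>V. A a b) * ((n - 5)\<^sup>2 / 32)"
    by (simp add: sum_A)
  also have "\<dots> = (\<Sum>a\<in>V. \<Sum>b\<in>V. A a b * (S a b - (n - 5)\<^sup>2 / 32))"
    by (simp only: N_def sum_distrib_right right_diff_distrib sum_subtractf)
  also have "\<bar>\<dots>\<bar> \<le> (\<Sum>a\<in>V. \<Sum>b\<in>V. n powr (3 / 2))"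
  proof (intro sum_abs[THEN order_trans] sum_mono)
    fix a b assume "a \<in> V" "b \<in> V"
    then show "\<bar>A a b * (S a b - (n - 5)\<^sup>2 / 32)\<bar> \<le> n powr (3 / 2)"
      using common_neighbourhood_edges[of a b] unfolding S_def by (cases "adj a b") simp_all
  qed
  also have "\<dots> = n powr 2 * n powr (3 / 2)"
    using n1 by (simp add: power2_eq_square)
  also have "\<dots> = n powr (7 / 2)"
    by (subst powr_add[symmetric]) simp
  finally have main: "\<bar>N - n * (n - 1) / 2 * ((n - 5)\<^sup>2 / 32)\<bar> \<le> n powr (7 / 2)" .
  have "\<bar>n * (n - 1) / 2 * ((n - 5)\<^sup>2 / 32) - n ^ 4 / 64\<bar> \<le> n ^ 3"
  proof -
    have poly: "n * (n - 1) / 2 * ((n - 5)\<^sup>2 / 32) - n ^ 4 / 64 = n * (35 * n - 11 * n\<^sup>2 - 25) / 64"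
      by (simp add: power2_eq_square power4_eq_xxxx field_simps)
    have "n \<le> n\<^sup>2"
      using mult_left_mono[OF n1, of n] by (simp add: power2_eq_square)
    with n1 have "\<bar>35 * n - 11 * n\<^sup>2 - 25\<bar> \<le> 64 * n\<^sup>2"
      by linarith
    then have "n * \<bar>35 * n - 11 * n\<^sup>2 - 25\<bar> \<le> n * (64 * n\<^sup>2)"
      by (rule mult_left_mono) simp
    then show ?thesis
      unfolding poly by (simp add: abs_mult power2_eq_square power3_eq_cube)
  qed
  also have "n ^ 3 = n powr 3"
    using n1 by simp
  also have "\<dots> \<le> n powr (7 / 2)"
    using n1 by (intro powr_mono) auto
  finally show ?thesis
    using main unfolding N by linarith
qed

end

section \<open>The quadratic character of a finite field\<close>

locale paley_field = field R for R :: "'a ring" (structure) +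
  assumes order_mod_4: "order R mod 4 = 1"
begin

lemma finite_carrier: "finite (carrier R)"
  using order_mod_4 by (metis One_nat_def card.infinite mod_0 order_def zero_neq_one)

text \<open>
  The last conjunct says that \<open>g\<close> has order \<open>q - 1\<close>, in the form that compares exponents.
\<close>

definition primitive_element :: "'a \<Rightarrow> bool" where
  "primitive_element g \<longleftrightarrow> g \<in> carrier R \<and> carrier R - {\<zero>} = range (\<lambda>i::nat. g [^] i) \<and>
     (\<forall>i j :: nat. g [^] i = g [^] j \<longrightarrow> int (order R - 1) dvd int i - int j)"

lemma primitive_element_exists: "\<exists>g. primitive_element g"
proof -
  interpret G: group "mult_of R"
    by (rule field_mult_group)
  have pow_mult_of: "x [^]\<^bsub>mult_of R\<^esub> (i::nat) = x [^] i" for x i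
    by (simp add: nat_pow_mult_of)
  obtain g where g: "g \<in> carrier (mult_of R)"
    and gen: "carrier (mult_of R) = {g [^] i | i :: nat. i \<in> UNIV}"
    using finite_field_mult_group_has_gen[OF finite_carrier] by blast
  have "G.ord g \<noteq> 0"
    using G.ord_ge_1[OF finite_mult_of[OF finite_carrier] g] by simp
  then have "generate (mult_of R) {g} = carrier (mult_of R)"
    using G.generate_pow_nat[OF g] unfolding gen by (simp add: pow_mult_of)
  then have ord: "G.ord g = order R - 1"
    using G.generate_pow_card[OF g] order_mult_of[OF finite_carrier]
    by (metis order_def)
  have "int (order R - 1) dvd int i - int j" if "g [^] i = g [^] j" for i j :: nat
    using that G.int_pow_eq[OF g, of "int j" "int i"] by (simp add: int_pow_int pow_mult_of ord)
  moreover have "carrier R - {\<zero>} = range (\<lambda>i::nat. g [^] i)"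
    using gen by (simp add: full_SetCompr_eq)
  moreover have "g \<in> carrier R"
    using g by simp
  ultimately show ?thesis
    unfolding primitive_element_def by blast
qed

text \<open>
  The order \<open>q - 1\<close> of the multiplicative group is divisible by 4, so the exponent of a power of
  a primitive element is determined modulo 4.  Modulo 2 this makes the quadratic character
  readable from the exponent; modulo 4 it makes \<open>-1\<close> a square.
\<close>

lemma primitive_elementD:
  assumes "primitive_element g"
  shows "g \<in> carrier R" "carrier R - {\<zero>} = range (\<lambda>i::nat. g [^] i)"
    and "\<And>i j :: nat. g [^] i = g [^] j \<Longrightarrow> 4 dvd int i - int j"
proof -
  fix i j :: nat assume "g [^] i = g [^] j"
  then have "int (order R - 1) dvd int i - int j"
    using assms by (simp add: primitive_element_def)
  moreover have "4 dvd int (order R - 1)"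
    using order_mod_4 by presburger
  ultimately show "4 dvd int i - int j" by (rule dvd_trans[rotated])
qed (use assms in \<open>auto simp: primitive_element_def\<close>)

definition chi :: "'a \<Rightarrow> real" where
  "chi a = (if a = \<zero> then 0 else if quadratic_residue R a then 1 else -1)"

lemma chi_zero [simp]: "chi \<zero> = 0"
  by (simp add: chi_def)

lemma chi_power_of_primitive_element:
  fixes i :: nat
  assumes "primitive_element g"
  shows "chi (g [^] i) = (-1) ^ i"
proof -
  note g = primitive_elementD[OF assms]
  have nz: "g [^] i \<noteq> \<zero>"
    using g(2) by auto
  have "(\<exists>z\<in>carrier R. g [^] i = z [^] (2::nat)) \<longleftrightarrow> even i"
  proof
    assume "\<exists>z\<in>carrier R. g [^] i = z [^] (2::nat)"
    then obtain z where z: "z \<in> carrier R" "g [^] i = z [^] (2::nat)" by blast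
    have "z \<noteq> \<zero>" using nz z by (auto simp: nat_pow_zero)
    then obtain j :: nat where "z = g [^] j" using z(1) g(2) by auto
    then have "g [^] i = g [^] (j * 2)"
      using z(2) g(1) by (simp add: nat_pow_pow)
    then have "4 dvd int i - int (j * 2)" by (rule g(3))
    then show "even i" by presburger
  next
    assume "even i"
    then obtain j where "i = j * 2" by (metis dvdE mult.commute)
    then show "\<exists>z\<in>carrier R. g [^] i = z [^] (2::nat)"
      using g(1) by (intro bexI[of _ "g [^] j"]) (auto simp: nat_pow_pow)
  qed
  then show ?thesis
    using nz by (simp add: chi_def quadratic_residue_def minus_one_power_iff)
qed

lemma chi_mult:
  assumes "a \<in> carrier R" "b \<in> carrier R"
  shows "chi (a \<otimes> b) = chi a * chi b"
proof (cases "a = \<zero> \<or> b = \<zero>")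
  case True
  then show ?thesis using assms by auto
next
  case False
  obtain g where prim: "primitive_element g"
    using primitive_element_exists by blast
  note g = primitive_elementD[OF prim]
  obtain i j :: nat where ij: "a = g [^] i" "b = g [^] j"
    using g(2) False assms by blast
  then have "a \<otimes> b = g [^] (i + j)"
    using g(1) by (simp add: nat_pow_mult)
  then show ?thesis
    using ij chi_power_of_primitive_element[OF prim] by (simp add: power_add)
qed

lemma chi_one [simp]: "chi \<one> = 1"
  unfolding chi_def quadratic_residue_def
  by (auto intro!: bexI[of _ \<one>])

lemma chi_square: "a \<in> carrier R \<Longrightarrow> a \<noteq> \<zero> \<Longrightarrow> chi (a \<otimes> a) = 1"
  by (simp only: chi_mult) (simp add: chi_def)

text \<open>
  If \<open>-1 = g ^ i\<close> for a primitive element \<open>g\<close>, then \<open>g ^ (2 * i) = 1\<close>, so 4 divides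
  \<open>2 * i\<close> and \<open>i\<close> is even.  This step rests on \<open>q mod 4 = 1\<close> and not just on \<open>q\<close> being
  odd, and it is what makes Paley adjacency symmetric.
\<close>

lemma chi_uminus:
  assumes a: "a \<in> carrier R"
  shows "chi (\<ominus> a) = chi a"
proof -
  obtain g where prim: "primitive_element g"
    using primitive_element_exists by blast
  note g = primitive_elementD[OF prim]
  have "\<ominus> \<one> \<in> carrier R - {\<zero>}"
    by simp
  then obtain i :: nat where i: "\<ominus> \<one> = g [^] i"
    using g(2) by auto
  have "\<ominus> \<one> \<otimes> \<ominus> \<one> = \<one>"
    by (simp add: l_minus)
  then have "g [^] (i + i) = g [^] (0::nat)"
    using g(1) by (simp add: i flip: nat_pow_mult)
  then have "4 dvd int (i + i) - int 0" by (rule g(3))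
  then have "even i" by presburger
  then have "chi (\<ominus> \<one>) = 1"
    using chi_power_of_primitive_element[OF prim, of i] i by simp
  moreover have "\<ominus> a = \<ominus> \<one> \<otimes> a"
    using a by (simp add: l_minus)
  ultimately show ?thesis
    using a by (simp add: chi_mult)
qed

text \<open>Multiplication by a primitive element permutes the field and negates the character.\<close>

lemma sum_chi: "(\<Sum>x\<in>carrier R. chi x) = 0"
proof -
  obtain g where prim: "primitive_element g"
    using primitive_element_exists by blast
  note g = primitive_elementD[OF prim]
  have "g [^] (1::nat) \<in> carrier R - {\<zero>}"
    unfolding g(2) by (rule rangeI)
  then have g_nz: "g \<noteq> \<zero>"
    using g(1) by simp
  have "chi g = -1"
    using chi_power_of_primitive_element[OF prim, of 1] g(1) by simp
  have "bij_betw (\<lambda>x. g \<otimes> x) (carrier R) (carrier R)"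
    by (rule bij_betwI[where g = "\<lambda>x. inv g \<otimes> x"])
       (use g(1) g_nz in \<open>auto simp: field_Units simp flip: m_assoc\<close>)
  then have "(\<Sum>x\<in>carrier R. chi (g \<otimes> x)) = (\<Sum>x\<in>carrier R. chi x)"
    by (rule sum.reindex_bij_betw)
  then show ?thesis
    using g(1) \<open>chi g = -1\<close> by (simp add: chi_mult sum_negf)
qed

text \<open>
  For \<open>x \<noteq> 0\<close> the factor \<open>chi (x * x) = 1\<close> can be split off, leaving \<open>chi (1 + c / x)\<close>.
  As \<open>x\<close> runs through the nonzero elements, \<open>1 + c / x\<close> takes every value except \<open>1\<close>
  exactly once.
\<close>

lemma sum_chi_chi_shift:
  assumes c: "c \<in> carrier R" "c \<noteq> \<zero>"
  shows "(\<Sum>x\<in>carrier R. chi x * chi (x \<oplus> c)) = -1"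
proof -
  have "(\<Sum>x\<in>carrier R. chi x * chi (x \<oplus> c)) = (\<Sum>x\<in>carrier R - {\<zero>}. chi x * chi (x \<oplus> c))"
    by (subst sum.remove[OF finite_carrier zero_closed]) simp
  also have "\<dots> = (\<Sum>x\<in>carrier R - {\<zero>}. chi (\<one> \<oplus> c \<otimes> inv x))"
  proof (rule sum.cong[OF refl])
    fix x assume x: "x \<in> carrier R - {\<zero>}"
    then have x': "x \<in> carrier R" "x \<noteq> \<zero>" "inv x \<in> carrier R" "x \<otimes> inv x = \<one>"
      by (auto simp: field_Units)
    have "x \<oplus> c = x \<otimes> (\<one> \<oplus> c \<otimes> inv x)"
      using x' c by (simp add: r_distr m_lcomm)
    then have "chi x * chi (x \<oplus> c) = chi (x \<otimes> x) * chi (\<one> \<oplus> c \<otimes> inv x)"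
      using x' c by (simp add: chi_mult)
    then show "chi x * chi (x \<oplus> c) = chi (\<one> \<oplus> c \<otimes> inv x)"
      using chi_square x' by simp
  qed
  also have "\<dots> = (\<Sum>y\<in>carrier R - {\<one>}. chi y)"
  proof (rule sum.reindex_bij_betw, rule bij_betwI[where g = "\<lambda>y. c \<otimes> inv (y \<ominus> \<one>)"])
    have quot: "c \<otimes> inv w \<in> carrier R" "c \<otimes> inv w \<noteq> \<zero>" "c \<otimes> inv (c \<otimes> inv w) = w"
      if w: "w \<in> carrier R" "w \<noteq> \<zero>" for w
    proof -
      have w': "inv w \<in> carrier R" "inv w \<otimes> w = \<one>"
        using w by (auto simp: field_Units)
      then have "inv w \<noteq> \<zero>"
        using w by auto
      then show t: "c \<otimes> inv w \<in> carrier R" "c \<otimes> inv w \<noteq> \<zero>"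
        using w' c by (auto simp: integral_iff)
      then have t': "inv (c \<otimes> inv w) \<in> carrier R" "(c \<otimes> inv w) \<otimes> inv (c \<otimes> inv w) = \<one>"
        by (auto simp: field_Units)
      have "c \<otimes> inv (c \<otimes> inv w) = (inv w \<otimes> w) \<otimes> (c \<otimes> inv (c \<otimes> inv w))"
        using w' t' c by simp
      also have "\<dots> = ((c \<otimes> inv w) \<otimes> inv (c \<otimes> inv w)) \<otimes> w"
        using w w'(1) t'(1) c by (simp only: m_ac m_closed)
      finally show "c \<otimes> inv (c \<otimes> inv w) = w"
        using w t' by simp
    qed
    have shift: "\<one> \<oplus> t \<ominus> \<one> = t" "\<one> \<oplus> (t \<ominus> \<one>) = t" if "t \<in> carrier R" for t
      using that by (simp_all add: minus_eq a_ac r_neg r_neg1 r_neg2)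
    show "(\<lambda>x. \<one> \<oplus> c \<otimes> inv x) \<in> carrier R - {\<zero>} \<rightarrow> carrier R - {\<one>}"
      using quot by auto
    show "(\<lambda>y. c \<otimes> inv (y \<ominus> \<one>)) \<in> carrier R - {\<one>} \<rightarrow> carrier R - {\<zero>}"
      using quot by auto
    show "c \<otimes> inv ((\<one> \<oplus> c \<otimes> inv x) \<ominus> \<one>) = x" if "x \<in> carrier R - {\<zero>}" for x
      using that quot shift(1) by simp
    show "\<one> \<oplus> c \<otimes> inv (c \<otimes> inv (y \<ominus> \<one>)) = y" if "y \<in> carrier R - {\<one>}" for y
      using that quot(3)[of "y \<ominus> \<one>"] shift(2)[of y] by simp
  qed
  also have "\<dots> = -1"
    using sum_chi sum.remove[OF finite_carrier one_closed, of chi] by simp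
  finally show ?thesis .
qed

section \<open>The Paley graph\<close>

lemma quadratic_residue_conv_chi:
  "of_bool (quadratic_residue R a) = (1 + chi a - of_bool (a = \<zero>)) / 2"
  by (auto simp: chi_def quadratic_residue_def)

lemma quadratic_residue_iff_chi: "quadratic_residue R a \<longleftrightarrow> chi a = 1"
  by (auto simp: chi_def quadratic_residue_def)

lemma sum_reflect:
  fixes f :: "'a \<Rightarrow> real"
  assumes "x \<in> carrier R"
  shows "(\<Sum>z\<in>carrier R. f (x \<ominus> z)) = (\<Sum>z\<in>carrier R. f z)"
proof (rule sum.reindex_bij_betw)
  have "x \<ominus> (x \<ominus> z) = z" if "z \<in> carrier R" for z
    using assms that by (simp add: minus_eq minus_add r_neg1 r_neg2)
  then show "bij_betw (\<lambda>z. x \<ominus> z) (carrier R) (carrier R)"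
    by (intro bij_betwI[where g = "\<lambda>z. x \<ominus> z"]) (use assms in auto)
qed

lemma sum_chi_diff:
  assumes "x \<in> carrier R"
  shows "(\<Sum>z\<in>carrier R. chi (x \<ominus> z)) = 0"
  using sum_reflect[OF assms, of chi] sum_chi by simp

lemma sum_chi_diff_diff:
  assumes x: "x \<in> carrier R" and y: "y \<in> carrier R" and "x \<noteq> y"
  shows "(\<Sum>z\<in>carrier R. chi (x \<ominus> z) * chi (y \<ominus> z)) = -1"
proof -
  have "y \<ominus> z = (x \<ominus> z) \<oplus> (y \<ominus> x)" if z: "z \<in> carrier R" for z
  proof -
    have "(x \<ominus> z) \<oplus> (y \<ominus> x) = (y \<ominus> z) \<oplus> (x \<oplus> \<ominus> x)"
      using x y z by (simp only: minus_eq a_ac a_closed a_inv_closed)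
    then show ?thesis using x y z by (simp add: r_neg)
  qed
  then have "(\<Sum>z\<in>carrier R. chi (x \<ominus> z) * chi (y \<ominus> z))
      = (\<Sum>z\<in>carrier R. chi (x \<ominus> z) * chi ((x \<ominus> z) \<oplus> (y \<ominus> x)))"
    by (intro sum.cong) auto
  also have "\<dots> = (\<Sum>z\<in>carrier R. chi z * chi (z \<oplus> (y \<ominus> x)))"
    by (rule sum_reflect[OF x, of "\<lambda>z. chi z * chi (z \<oplus> (y \<ominus> x))"])
  also have "\<dots> = -1"
    using assms by (intro sum_chi_chi_shift) auto
  finally show ?thesis .
qed

lemma chi_diff_commute:
  assumes "x \<in> carrier R" "y \<in> carrier R"
  shows "chi (x \<ominus> y) = chi (y \<ominus> x)"
proof -
  have "x \<ominus> y = \<ominus> (y \<ominus> x)"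
    using assms by (simp add: minus_eq minus_add a_comm)
  then show ?thesis
    using assms by (simp add: chi_uminus)
qed

abbreviation paley_adj :: "'a \<Rightarrow> 'a \<Rightarrow> bool" where
  "paley_adj x y \<equiv> quadratic_residue R (x \<ominus> y)"

lemma of_bool_paley_adj:
  assumes "x \<in> carrier R" "y \<in> carrier R"
  shows "of_bool (paley_adj x y) = (1 + chi (x \<ominus> y) - of_bool (y = x)) / 2"
  using assms by (auto simp: quadratic_residue_conv_chi)

lemma paley_degree:
  assumes x: "x \<in> carrier R"
  shows "2 * card {z \<in> carrier R. paley_adj x z} + 1 = card (carrier R)"
proof -
  have "real (card {z \<in> carrier R. paley_adj x z}) = (\<Sum>z\<in>carrier R. of_bool (paley_adj x z))"
    using finite_carrier by (simp add: Int_def)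
  also have "\<dots> = (\<Sum>z\<in>carrier R. (1 + chi (x \<ominus> z) - of_bool (z = x)) / 2)"
    using of_bool_paley_adj[OF x] by (intro sum.cong refl) auto
  also have "\<dots> = (real (card (carrier R)) - 1) / 2"
    using x finite_carrier
    by (simp add: sum.distrib sum_subtractf sum_chi_diff of_bool_def flip: sum_divide_distrib)
  finally show ?thesis by simp
qed

text \<open>
  For \<open>z\<close> other than \<open>x\<close> and \<open>y\<close>, four times the indicator of a common neighbour is
  \<open>(1 + chi (x - z)) * (1 + chi (y - z))\<close>.  Summed over the whole field, this product gives
  \<open>q - 1\<close>, as the linear terms vanish and the correlation is \<open>-1\<close>.  At \<open>z = x\<close> and
  \<open>z = y\<close> the indicator is \<open>0\<close> but the product is \<open>1 + chi (x - y)\<close>, so twice this value is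
  subtracted.
\<close>

lemma paley_codegree:
  assumes x: "x \<in> carrier R" and y: "y \<in> carrier R" and ne: "x \<noteq> y"
  shows "4 * real (card {z \<in> carrier R. paley_adj x z \<and> paley_adj y z})
         = real (card (carrier R)) - 3 - 2 * chi (x \<ominus> y)"
proof -
  have "4 * real (card {z \<in> carrier R. paley_adj x z \<and> paley_adj y z})
      = (\<Sum>z\<in>carrier R. 4 * (of_bool (paley_adj x z) * of_bool (paley_adj y z)))"
    using finite_carrier by (simp add: Int_def flip: of_bool_conj sum_distrib_left)
  also have "\<dots> = (\<Sum>z\<in>carrier R. 1 + chi (x \<ominus> z) + chi (y \<ominus> z) + chi (x \<ominus> z) * chi (y \<ominus> z)
      - (if z = x then 1 + chi (y \<ominus> x) else 0) - (if z = y then 1 + chi (x \<ominus> y) else 0))"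
  proof (rule sum.cong[OF refl])
    fix z assume z: "z \<in> carrier R"
    show "4 * (of_bool (paley_adj x z) * of_bool (paley_adj y z))
      = 1 + chi (x \<ominus> z) + chi (y \<ominus> z) + chi (x \<ominus> z) * chi (y \<ominus> z)
      - (if z = x then 1 + chi (y \<ominus> x) else 0) - (if z = y then 1 + chi (x \<ominus> y) else 0)"
      unfolding of_bool_paley_adj[OF x z] of_bool_paley_adj[OF y z]
      using x y z ne by (auto simp: algebra_simps)
  qed
  also have "\<dots> = real (card (carrier R)) - 3 - 2 * chi (x \<ominus> y)"
    using x y finite_carrier chi_diff_commute[OF x y]
    by (simp add: sum.distrib sum_subtractf sum_chi_diff sum_chi_diff_diff[OF x y ne])
  finally show ?thesis .
qed

lemma conference_graph_paley: "conference_graph (carrier R) paley_adj"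
proof
  fix x y assume xy: "x \<in> carrier R" "y \<in> carrier R"
  show "paley_adj x y \<Longrightarrow> paley_adj y x"
    using chi_diff_commute[OF xy] by (simp add: quadratic_residue_iff_chi)
  show "4 * card {z \<in> carrier R. paley_adj x z \<and> paley_adj y z} + 5 = card (carrier R)"
    if adj: "paley_adj x y"
  proof -
    have "chi (x \<ominus> y) = 1"
      using adj by (simp add: quadratic_residue_iff_chi)
    moreover from this have "x \<noteq> y"
      using xy by (auto simp: minus_eq r_neg)
    ultimately show ?thesis
      using paley_codegree[OF xy] by simp
  qed
  show "4 * card {z \<in> carrier R. paley_adj x z \<and> paley_adj y z} + 1 = card (carrier R)"
    if ne: "x \<noteq> y" and adj: "\<not> paley_adj x y"
  proof -
    have "chi (x \<ominus> y) = -1"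
      using adj xy ne by (auto simp: chi_def)
    then show ?thesis
      using paley_codegree[OF xy ne] by simp
  qed
qed (use finite_carrier paley_degree in \<open>auto simp: quadratic_residue_def minus_eq r_neg\<close>)

text \<open>
  An edge is an unordered pair with a residue as its difference in one of the two orders;
  by symmetry the order is immaterial.
\<close>

lemma clique_paley_edges:
  assumes "K \<subseteq> carrier R"
  shows "clique K (paley_edges R) \<longleftrightarrow> (\<forall>x\<in>K. \<forall>y\<in>K. x \<noteq> y \<longrightarrow> paley_adj x y)"
proof -
  have "{x, y} \<in> paley_edges R \<longleftrightarrow> paley_adj x y" if "x \<in> K" "y \<in> K" "x \<noteq> y" for x y
  proof -
    have "x \<in> carrier R" "y \<in> carrier R" using assms that by auto
    then show ?thesis
      using that conference_graph.adj_sym[OF conference_graph_paley]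
      unfolding paley_edges_def by (auto simp: doubleton_eq_iff)
  qed
  then show ?thesis unfolding clique_def by blast
qed

lemma k4_estimate: "\<bar>real (k4 R) - real (order R) ^ 4 / 1536\<bar> \<le> real (order R) powr (7 / 2) / 12"
proof -
  have "k4 R = card {K. K \<subseteq> carrier R \<and> card K = 4 \<and> (\<forall>x\<in>K. \<forall>y\<in>K. x \<noteq> y \<longrightarrow> paley_adj x y)}"
    unfolding k4_def using clique_paley_edges by (intro arg_cong[of _ _ card]) auto
  then show ?thesis
    using conference_graph.card_4_cliques[OF conference_graph_paley] by (simp add: order_def)
qed

end

lemma k4_GF:
  assumes "paley_order q" "F \<in> GF q"
  shows "\<bar>real (k4 F) - real q ^ 4 / 1536\<bar> \<le> real q powr (7 / 2) / 12"
proof -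
  have "field F" "order F = q"
    using assms by (auto simp: GF_def)
  then interpret paley_field F
    using assms by (simp add: paley_field_def paley_field_axioms_def paley_order_def)
  show ?thesis
    using k4_estimate \<open>order F = q\<close> by simp
qed

theorem theorem5p2:
  shows "(\<exists>C::real. \<forall>q. paley_order q \<longrightarrow>
            (\<forall>F\<in>(GF q :: 'a ring set).
               \<bar>real (k4 F) - real q ^ 4 / 1536\<bar> \<le> C * real q powr (7 / 2)))
       \<and> (\<lambda>F. real (k4 F)) \<sim>[(paley_at_top :: 'a ring filter)]
            (\<lambda>F. real (Coset.order F) ^ 4 / 1536)"
proof
  show "\<exists>C::real. \<forall>q. paley_order q \<longrightarrow>
          (\<forall>F\<in>(GF q :: 'a ring set).
             \<bar>real (k4 F) - real q ^ 4 / 1536\<bar> \<le> C * real q powr (7 / 2))"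
    using k4_GF by (intro exI[of _ "1 / 12"]) auto
next
  have order_at_top: "filterlim (\<lambda>F. real (order F)) at_top (paley_at_top :: 'a ring filter)"
    unfolding paley_at_top_def
    by (intro filterlim_compose[OF filterlim_real_sequentially] filterlim_inf[THEN iffD2]
          filterlim_mono[OF filterlim_filtercomap order_refl] inf_le1)
  \<comment> \<open>\<open>128 = 1536 / 12\<close> comes from dividing the error bound by the main term.\<close>
  show "(\<lambda>F. real (k4 F)) \<sim>[(paley_at_top :: 'a ring filter)] (\<lambda>F. real (order F) ^ 4 / 1536)"
  proof (rule asymp_equivI', rule LIM_zero_cancel, rule tendsto_0_le)
    show "((\<lambda>F. real (order F) powr (- (1 / 2))) \<longlongrightarrow> 0) (paley_at_top :: 'a ring filter)"
      by (rule tendsto_neg_powr[OF _ order_at_top]) simp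
    have "\<forall>\<^sub>F F in (paley_at_top :: 'a ring filter). F \<in> (\<Union>q\<in>{q. paley_order q}. GF q)"
      unfolding paley_at_top_def eventually_inf_principal by (rule always_eventually) blast
    then show "\<forall>\<^sub>F F in (paley_at_top :: 'a ring filter).
        norm (real (k4 F) / (real (order F) ^ 4 / 1536) - 1) \<le> norm (real (order F) powr (- (1 / 2))) * 128"
    proof eventually_elim
      case (elim F)
      define q where "q = order F"
      have q: "paley_order q" "F \<in> GF q"
        using elim by (auto simp: q_def GF_def)
      then have q0: "real q > 0"
        by (cases "q = 0") (auto simp: paley_order_def)
      have "norm (real (k4 F) / (real q ^ 4 / 1536) - 1)
          = \<bar>real (k4 F) - real q ^ 4 / 1536\<bar> * (1536 / real q ^ 4)"
      proof -
        have "real (k4 F) / (real q ^ 4 / 1536) - 1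
            = (real (k4 F) - real q ^ 4 / 1536) * (1536 / real q ^ 4)"
          using q0 by (simp add: field_simps)
        then show ?thesis by (simp only: real_norm_def abs_mult) simp
      qed
      also have "\<dots> \<le> real q powr (7 / 2) / 12 * (1536 / real q ^ 4)"
        by (intro mult_right_mono k4_GF[OF q]) simp
      also have "\<dots> = 128 * (real q powr (7 / 2) / real q powr 4)"
        using q0 by (simp add: powr_numeral)
      also have "real q powr (7 / 2) / real q powr 4 = real q powr (- (1 / 2))"
        by (subst powr_diff[symmetric]) simp
      finally show ?case by (simp add: q_def)
    qed
  qed
qed

end
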